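(* Let $p>3$ be a prime and let $f\in\mathcal{K}_{p,2}$ satisfy $\Delta_f=0$, $\Delta_f(2)\in\mathbb{Z}_p^*$, and suppose $f$ has a zero in $\mathbb{Z}_p$. Then $f$ has two zeros $\xi_1,\xi_2\in\mathbb{Z}_p$ such that \[ f(s)=p^2(s-\xi_1)(s-\xi_2)f^*(s),\qquad |f(s)|_p=|p^2(s-\xi_1)(s-\xi_2)|_p,\qquad s\in\mathbb{Z}_p, \] where $f^*:\mathbb{Z}_p\to\mathbb{Z}_p^*$ is continuous and $f^*(s)\equiv\Delta_f(2)/2\pmod{p\mathbb{Z}_p}$.
   Context: Let $\Delta^n f(s)=\sum_{\nu=0}^n\binom{n}{\nu}(-1)^{n-\nu}f(s+\nu)$. $\mathcal{K}_{p,2}$ is the set of $f:\mathbb{Z}_p\to\mathbb{Z}_p$ with $\Delta^n f(s)\equiv0\pmod{p^n\mathbb{Z}_p}$ for all $s\in\mathbb{Z}_p$, $n\ge0$. For $f\in\mathcal{K}_{p,2}$, $\Delta_f(n)=\Delta^nf(0)/p^n\in\mathbb{Z}_p$ and $\Delta_f$ is the integer in $[0,p)$ congruent to $\Delta_f(1)$ mod $p$ (so $\Delta_f=0$ means $\Delta_f(1)\in p\mathbb{Z}_p$).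
   Formalization: The formal theorem also assumes f is continuous; without it the claim fails (f(s)=p^2 s^2 on the integers, f(s)=1 elsewhere in Z_p), and the stated factorization with continuous f^* forces f to be continuous anyway. *)

theory Defs
  imports "HOL-Analysis.Analysis" "Berlekamp_Zassenhaus.Finite_Field"
begin

text \<open>
  The ring of \<open>p\<close>-adic integers, for \<open>p = CARD('p)\<close> prime, as the inverse limit of the rings
  \<open>\<int>/p\<^sup>n\<int>\<close>. Since \<open>y mod p\<^sup>n\<close> lies in \<open>[0, p\<^sup>n)\<close>, the single condition below expresses both
  that \<open>x n\<close> is a reduced residue modulo \<open>p\<^sup>n\<close> and that the residues are compatible.
\<close>

typedef (overloaded) ('p :: prime_card) padic_int =
  "{x :: nat \<Rightarrow> int. \<forall>n. x n = x (Suc n) mod int CARD('p) ^ n}"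
  by (rule exI[of _ "\<lambda>_. 0"]) simp

setup_lifting type_definition_padic_int

lemma padic_int_eqI:
  "(\<And>n. Rep_padic_int x n = Rep_padic_int y n) \<Longrightarrow> x = y"
  by (metis Rep_padic_int_inject ext)

lemma Rep_padic_int_step:
  "Rep_padic_int (x :: 'p :: prime_card padic_int) n =
     Rep_padic_int x (Suc n) mod int CARD('p) ^ n"
  using Rep_padic_int[of x] by blast

lemma Rep_padic_int_mod:
  "Rep_padic_int (x :: 'p :: prime_card padic_int) (n + k) mod int CARD('p) ^ n = Rep_padic_int x n"
proof (induction k)
  case 0
  show ?case
    by (metis Rep_padic_int_step add_0_right mod_mod_trivial)
next
  case (Suc k)
  have "Rep_padic_int x (n + k) mod int CARD('p) ^ n =
        Rep_padic_int x (n + Suc k) mod int CARD('p) ^ (n + k) mod int CARD('p) ^ n"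
    by (subst Rep_padic_int_step) simp
  also have "\<dots> = Rep_padic_int x (n + Suc k) mod int CARD('p) ^ n"
    by (rule mod_mod_cancel) (simp add: power_add)
  finally show ?case using Suc by simp
qed

lemma mod_power_Suc: "(x :: int) mod m ^ Suc n mod m ^ n = x mod m ^ n"
  by (simp add: mod_mod_cancel)

instantiation padic_int :: (prime_card) comm_ring_1
begin

lift_definition zero_padic_int :: "'a padic_int" is "\<lambda>_. 0" by simp

lift_definition one_padic_int :: "'a padic_int" is "\<lambda>n. 1 mod int CARD('a) ^ n"
  by (metis mod_power_Suc)

lift_definition plus_padic_int :: "'a padic_int \<Rightarrow> 'a padic_int \<Rightarrow> 'a padic_int"
  is "\<lambda>x y n. (x n + y n) mod int CARD('a) ^ n"
  by (metis mod_power_Suc mod_add_eq)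

lift_definition minus_padic_int :: "'a padic_int \<Rightarrow> 'a padic_int \<Rightarrow> 'a padic_int"
  is "\<lambda>x y n. (x n - y n) mod int CARD('a) ^ n"
  by (metis mod_power_Suc mod_diff_eq)

lift_definition uminus_padic_int :: "'a padic_int \<Rightarrow> 'a padic_int"
  is "\<lambda>x n. (- x n) mod int CARD('a) ^ n"
  by (metis mod_power_Suc mod_minus_eq)

lift_definition times_padic_int :: "'a padic_int \<Rightarrow> 'a padic_int \<Rightarrow> 'a padic_int"
  is "\<lambda>x y n. (x n * y n) mod int CARD('a) ^ n"
  by (metis mod_power_Suc mod_mult_eq)

instance
proof
  fix a b c :: "'a padic_int"
  note rep = plus_padic_int.rep_eq times_padic_int.rep_eq minus_padic_int.rep_eq
    uminus_padic_int.rep_eq zero_padic_int.rep_eq one_padic_int.rep_eq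
  have mod_self: "Rep_padic_int x n mod int CARD('a) ^ n = Rep_padic_int x n"
    for x :: "'a padic_int" and n
    using Rep_padic_int_mod[of x n 0] by simp
  show "a * b * c = a * (b * c)"
    by (rule padic_int_eqI) (simp add: rep mod_simps algebra_simps)
  show "a * b = b * a"
    by (rule padic_int_eqI) (simp add: rep algebra_simps)
  show "1 * a = a"
    by (rule padic_int_eqI) (simp add: rep mod_simps mod_self)
  show "a + b + c = a + (b + c)"
    by (rule padic_int_eqI) (simp add: rep mod_simps algebra_simps)
  show "a + b = b + a"
    by (rule padic_int_eqI) (simp add: rep algebra_simps)
  show "0 + a = a"
    by (rule padic_int_eqI) (simp add: rep mod_self)
  show "- a + a = 0"
    by (rule padic_int_eqI) (simp add: rep mod_simps)
  show "a - b = a + - b"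
    by (rule padic_int_eqI) (simp add: rep mod_simps)
  show "(a + b) * c = a * c + b * c"
    by (rule padic_int_eqI) (simp add: rep mod_simps algebra_simps)
  have "int CARD('a) > 1"
    using prime_gt_1_int[OF prime_card_int[where 'a = 'a]] .
  then have "Rep_padic_int (0 :: 'a padic_int) 1 \<noteq> Rep_padic_int (1 :: 'a padic_int) 1"
    by (simp add: rep)
  then show "(0 :: 'a padic_int) \<noteq> 1" by metis
qed

end

lemma Rep_padic_int_of_int:
  "Rep_padic_int (of_int k :: 'p :: prime_card padic_int) n = k mod int CARD('p) ^ n"
proof (induction k rule: int_induct[where k = 0])
  case base
  show ?case by (simp add: zero_padic_int.rep_eq)
next
  case (step1 i)
  then show ?case
    by (simp add: plus_padic_int.rep_eq one_padic_int.rep_eq mod_simps)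
next
  case (step2 i)
  then show ?case
    by (simp add: minus_padic_int.rep_eq one_padic_int.rep_eq mod_simps)
qed

instance padic_int :: (prime_card) idom
proof
  fix a b :: "'a padic_int"
  let ?p = "int CARD('a)"
  have p: "prime_elem ?p" using prime_card_int[where 'a = 'a] by simp
  have nu: "\<not> is_unit ?p" using p by (rule prime_elem_not_unit)
  assume "a \<noteq> 0" "b \<noteq> 0"
  then obtain k m where k: "Rep_padic_int a k \<noteq> 0" and m: "Rep_padic_int b m \<noteq> 0"
    by (metis Rep_padic_int_inject zero_padic_int.rep_eq ext)
  let ?x = "Rep_padic_int a (k + m)" and ?y = "Rep_padic_int b (k + m)"
  have x: "\<not> ?p ^ k dvd ?x"
    using k Rep_padic_int_mod[of a k m] by (simp add: dvd_eq_mod_eq_0)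
  have y: "\<not> ?p ^ m dvd ?y"
    using m Rep_padic_int_mod[of b m k] by (simp add: dvd_eq_mod_eq_0 add.commute)
  have x0: "?x \<noteq> 0" and y0: "?y \<noteq> 0" using x y by auto
  have "multiplicity ?p ?x < k" "multiplicity ?p ?y < m"
    using x y x0 y0 nu by (auto simp: power_dvd_iff_le_multiplicity)
  then have "multiplicity ?p (?x * ?y) < k + m"
    using prime_elem_multiplicity_mult_distrib[OF p x0 y0] by simp
  then have "\<not> ?p ^ (k + m) dvd ?x * ?y"
    using x0 y0 nu by (subst power_dvd_iff_le_multiplicity) auto
  then have "Rep_padic_int (a * b) (k + m) \<noteq> 0"
    by (simp add: times_padic_int.rep_eq dvd_eq_mod_eq_0)
  then show "a * b \<noteq> 0" by (auto simp: zero_padic_int.rep_eq)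
qed

text \<open>Division is exact division, with the junk value \<open>0\<close> when the quotient is not integral.
  In particular \<open>x div 2\<close> is the true quotient for odd \<open>p\<close>, as \<open>2\<close> is then a unit.\<close>

instantiation padic_int :: (prime_card) algebraic_semidom
begin

definition divide_padic_int :: "'a padic_int \<Rightarrow> 'a padic_int \<Rightarrow> 'a padic_int" where
  "divide_padic_int x y = (if y \<noteq> 0 \<and> y dvd x then (THE z. x = z * y) else 0)"

instance
  by standard (auto simp: divide_padic_int_def)

end

instance padic_int :: (prime_card) idom_divide ..

lemma p_power_dvd_iff:
  "of_nat CARD('p) ^ n dvd (x :: 'p :: prime_card padic_int) \<longleftrightarrow> Rep_padic_int x n = 0"
proof
  let ?p = "int CARD('p)"
  have pn: "of_nat CARD('p) ^ n = (of_int (?p ^ n) :: 'p padic_int)" by simp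
  {
    assume "of_nat CARD('p) ^ n dvd x"
    then obtain z where "x = of_int (?p ^ n) * z" unfolding pn by blast
    then show "Rep_padic_int x n = 0"
      by (simp add: times_padic_int.rep_eq Rep_padic_int_of_int del: of_int_power)
  next
    assume x: "Rep_padic_int x n = 0"
    define z where "z = (\<lambda>k. Rep_padic_int x (n + k) div ?p ^ n)"
    have "z k = z (Suc k) mod ?p ^ k" for k
    proof -
      have "z k = Rep_padic_int x (n + Suc k) mod (?p ^ n * ?p ^ k) div ?p ^ n"
        unfolding z_def by (subst Rep_padic_int_step) (simp add: power_add)
      also have "\<dots> = z (Suc k) mod ?p ^ k"
        using prime_gt_0_int[OF prime_card_int[where 'a = 'p]]
        by (simp add: z_def zmod_zmult2_eq)
      finally show ?thesis .
    qed
    then have z: "Rep_padic_int (Abs_padic_int z :: 'p padic_int) = z"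
      by (intro Abs_padic_int_inverse) blast
    have "Rep_padic_int x k = Rep_padic_int (of_int (?p ^ n) * (Abs_padic_int z :: 'p padic_int)) k" for k
    proof -
      have "?p ^ n dvd Rep_padic_int x (n + k)"
        using x Rep_padic_int_mod[of x n k] by (simp add: dvd_eq_mod_eq_0)
      then have "?p ^ n * z k = Rep_padic_int x (n + k)" by (simp add: z_def)
      then show ?thesis
        using Rep_padic_int_mod[of x k n]
        by (simp add: times_padic_int.rep_eq Rep_padic_int_of_int z mod_simps add.commute
              del: of_int_power)
    qed
    then have "x = of_int (?p ^ n) * (Abs_padic_int z :: 'p padic_int)"
      by (rule padic_int_eqI)
    then show "of_nat CARD('p) ^ n dvd x" unfolding pn by (rule dvdI)
  }
qed

text \<open>The \<open>p\<close>-adic absolute value, normalised by \<open>|p| = 1/p\<close>.\<close>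

definition padic_abs :: "'p :: prime_card padic_int \<Rightarrow> real" where
  "padic_abs x =
     (if x = 0 then 0 else 1 / real CARD('p) ^ Max {n. of_nat CARD('p) ^ n dvd x})"

lemma finite_p_power_dvd:
  assumes "(x :: 'p :: prime_card padic_int) \<noteq> 0"
  shows "finite {n. of_nat CARD('p) ^ n dvd x}"
proof -
  obtain k where k: "Rep_padic_int x k \<noteq> 0"
    using assms by (metis Rep_padic_int_inject zero_padic_int.rep_eq ext)
  have "n < k" if "of_nat CARD('p) ^ n dvd x" for n
  proof (rule ccontr)
    assume "\<not> n < k"
    then have "of_nat CARD('p) ^ k dvd x" using that by (metis dvd_trans le_imp_power_dvd not_less)
    with k show False by (simp add: p_power_dvd_iff)
  qed
  then show ?thesis by (metis bounded_nat_set_is_finite mem_Collect_eq)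
qed

lemma padic_abs_le_iff:
  "padic_abs (x :: 'p :: prime_card padic_int) \<le> 1 / real CARD('p) ^ n \<longleftrightarrow> of_nat CARD('p) ^ n dvd x"
proof (cases "x = 0")
  case False
  let ?S = "{n. of_nat CARD('p) ^ n dvd x}"
  have fin: "finite ?S" by (rule finite_p_power_dvd[OF False])
  have ne: "0 \<in> ?S" by simp
  have p: "real CARD('p) > 1" using prime_gt_1_nat[OF prime_card[where 'a = 'p]] by simp
  have "padic_abs x \<le> 1 / real CARD('p) ^ n \<longleftrightarrow> n \<le> Max ?S"
    using False p by (simp add: padic_abs_def field_simps)
  also have "\<dots> \<longleftrightarrow> n \<in> ?S"
  proof
    assume "n \<le> Max ?S"
    moreover have "Max ?S \<in> ?S" by (rule Max_in[OF fin]) (use ne in blast)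
    ultimately show "n \<in> ?S" by (metis dvd_trans le_imp_power_dvd mem_Collect_eq)
  qed (use fin in simp)
  finally show ?thesis by simp
qed (simp add: padic_abs_def)

lemma padic_abs_minus_commute: "padic_abs (x - y :: 'p :: prime_card padic_int) = padic_abs (y - x)"
proof -
  have "z dvd x - y \<longleftrightarrow> z dvd y - x" for z by (metis dvd_minus_iff minus_diff_eq)
  then show ?thesis by (auto simp: padic_abs_def)
qed

lemma padic_abs_add_le_max: "padic_abs (x + y :: 'p :: prime_card padic_int) \<le> max (padic_abs x) (padic_abs y)"
proof -
  have *: "padic_abs (u + v) \<le> padic_abs u" if "padic_abs v \<le> padic_abs u" for u v :: "'p padic_int"
  proof (cases "u = 0")
    case True
    with that have "padic_abs v \<le> 0" by (simp add: padic_abs_def)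
    moreover have "padic_abs v > 0" if "v \<noteq> 0"
      using that prime_gt_0_nat[OF prime_card[where 'a = 'p]] by (simp add: padic_abs_def)
    ultimately have "v = 0" by fastforce
    with True show ?thesis by simp
  next
    case False
    then obtain n where n: "padic_abs u = 1 / real CARD('p) ^ n" by (auto simp: padic_abs_def)
    with that show ?thesis by (metis dvd_add padic_abs_le_iff order_refl)
  qed
  show ?thesis using *[of x y] *[of y x] by (auto simp: max_def add.commute)
qed

instantiation padic_int :: (prime_card) metric_space
begin

definition dist_padic_int :: "'a padic_int \<Rightarrow> 'a padic_int \<Rightarrow> real" where
  "dist_padic_int x y = padic_abs (x - y)"

definition uniformity_padic_int :: "('a padic_int \<times> 'a padic_int) filter" where
  "uniformity_padic_int = (INF e\<in>{0<..}. principal {(x, y). dist x y < e})"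

definition open_padic_int :: "'a padic_int set \<Rightarrow> bool" where
  "open_padic_int U \<longleftrightarrow> (\<forall>x\<in>U. eventually (\<lambda>(x', y). x' = x \<longrightarrow> y \<in> U) uniformity)"

instance
proof
  show "(uniformity :: ('a padic_int \<times> 'a padic_int) filter) =
          (INF e\<in>{0<..}. principal {(x, y). dist x y < e})"
    by (rule uniformity_padic_int_def)
  show "open U \<longleftrightarrow> (\<forall>x\<in>U. eventually (\<lambda>(x', y). x' = x \<longrightarrow> y \<in> U) uniformity)"
    for U :: "'a padic_int set"
    by (rule open_padic_int_def)
  fix x y z :: "'a padic_int"
  show "dist x y = 0 \<longleftrightarrow> x = y" by (simp add: dist_padic_int_def padic_abs_def)
  have nn: "padic_abs u \<ge> 0" for u :: "'a padic_int" by (simp add: padic_abs_def)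
  have "padic_abs (x - y) \<le> max (padic_abs (x - z)) (padic_abs (y - z))"
    using padic_abs_add_le_max[of "x - z" "z - y"] padic_abs_minus_commute[of y z] by simp
  then show "dist x y \<le> dist x z + dist y z"
    using nn[of "x - z"] nn[of "y - z"] unfolding dist_padic_int_def by linarith
qed

end

definition fdiff :: "nat \<Rightarrow> ('a :: comm_ring_1 \<Rightarrow> 'a) \<Rightarrow> 'a \<Rightarrow> 'a" where
  "fdiff n f s = (\<Sum>\<nu>=0..n. of_nat (n choose \<nu>) * (- 1) ^ (n - \<nu>) * f (s + of_nat \<nu>))"

text \<open>
  Membership constrains \<open>f\<close> only along each coset of the dense subgroup \<open>\<int>\<close> of \<open>\<int>\<^sub>p\<close>, so it does
  not imply continuity: any function that is constant on each coset is a member. Continuity, which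
  Mahler expansions of such \<open>f\<close> require, has to be assumed separately.
\<close>

definition kummer2 :: "('p :: prime_card padic_int \<Rightarrow> 'p padic_int) set" where
  "kummer2 = {f. \<forall>s n. of_nat CARD('p) ^ n dvd fdiff n f s}"

definition Delta_coeff ::
  "('p :: prime_card padic_int \<Rightarrow> 'p padic_int) \<Rightarrow> nat \<Rightarrow> 'p padic_int" where
  "Delta_coeff f n = fdiff n f 0 div of_nat CARD('p) ^ n"

definition Delta_res :: "('p :: prime_card padic_int \<Rightarrow> 'p padic_int) \<Rightarrow> int" where
  "Delta_res f =
     (THE k. 0 \<le> k \<and> k < int CARD('p) \<and> of_nat CARD('p) dvd Delta_coeff f 1 - of_int k)"

lemma ex1_residue:
  "\<exists>!k. 0 \<le> k \<and> k < int CARD('p) \<and> of_nat CARD('p) dvd (x :: 'p :: prime_card padic_int) - of_int k"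
proof -
  let ?p = "int CARD('p)"
  have p: "?p > 0" using prime_gt_0_int[OF prime_card_int[where 'a = 'p]] .
  have x: "0 \<le> Rep_padic_int x 1" "Rep_padic_int x 1 < ?p"
    using p Rep_padic_int_mod[of x 1 0] by (metis pos_mod_sign pos_mod_bound power_one_right)+
  have "of_nat CARD('p) dvd x - of_int k \<longleftrightarrow> Rep_padic_int x 1 = k" if "0 \<le> k" "k < ?p" for k
    using that p x p_power_dvd_iff[of 1 "x - of_int k"]
    by (simp add: minus_padic_int.rep_eq Rep_padic_int_of_int)
       (metis mod_eq_dvd_iff mod_pos_pos_trivial dvd_eq_mod_eq_0)
  then show ?thesis using x by blast
qed

end

theory Submission
  imports Defs
begin

text \<open>
  For \<open>p > 3\<close> the quotients \<open>D\<^sub>n = p\<^sup>n / n!\<close> are \<open>p\<close>-adic integers tending to \<open>0\<close>, and \<open>p\<^sup>3\<close> divides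
  \<open>D\<^sub>n\<close> for \<open>n \<ge> 3\<close>. Around a zero \<open>\<xi>\<close>, the Newton expansion of \<open>f\<close> is therefore a series
  \<open>f (\<xi> + t) = \<Sum> c\<^sub>n t (t - 1) \<dots> (t - n + 1)\<close> with integral coefficients: \<open>c\<^sub>0 = 0\<close>, and since
  \<open>\<Delta>\<^sup>n f (\<xi>) / p\<^sup>n\<close> is congruent to \<open>\<Delta>\<^sub>f(n)\<close> modulo \<open>p\<close>, all \<open>c\<^sub>n\<close> are divisible by \<open>p\<^sup>2\<close>, with
  \<open>c\<^sub>2 / p\<^sup>2\<close> a unit congruent to \<open>\<Delta>\<^sub>f(2) / 2\<close> and \<open>c\<^sub>n / p\<^sup>2\<close> divisible by \<open>p\<close> for \<open>n \<ge> 3\<close>. Hence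
  \<open>f (\<xi> + t) = p\<^sup>2 t H (t - 1)\<close>, where \<open>H\<close> is again such a series and is linear with unit slope modulo
  \<open>p\<close>. Its divided differences are congruent to that slope, so \<open>H\<close> has a zero by Newton iteration,
  and the divided difference at this zero is the cofactor \<open>f\<^sup>*\<close>.
\<close>

abbreviation padic_p :: "'p :: prime_card padic_int" where
  "padic_p \<equiv> of_nat CARD('p)"

subsection \<open>Convergence and units in the p-adic integers\<close>

lemma padic_dist_le_iff:
  "dist x (y :: 'p :: prime_card padic_int) \<le> 1 / real CARD('p) ^ n \<longleftrightarrow> padic_p ^ n dvd x - y"
  by (simp add: dist_padic_int_def padic_abs_le_iff)

lemma padic_card_gt_1: "real CARD('p :: prime_card) > 1"
  using prime_gt_1_nat[OF prime_card[where 'a = 'p]] by simp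

lemma ex_padic_radius_less:
  assumes "e > 0"
  shows "\<exists>n. 1 / real CARD('p :: prime_card) ^ n < e"
  using real_arch_pow_inv[OF assms, of "1 / real CARD('p)"] padic_card_gt_1[where 'p = 'p]
  by (auto simp: power_one_over)

text \<open>Balls of radius \<open>1 / p ^ N\<close> form a neighbourhood basis, so limits turn into
  congruences; later convergence arguments use divisibility alone.\<close>

lemma tendsto_padic_iff:
  "(X \<longlongrightarrow> (L :: 'p :: prime_card padic_int)) F \<longleftrightarrow>
     (\<forall>N. \<forall>\<^sub>F i in F. padic_p ^ N dvd X i - L)"
proof
  assume lim: "(X \<longlongrightarrow> L) F"
  show "\<forall>N. \<forall>\<^sub>F i in F. padic_p ^ N dvd X i - L"
  proof
    fix N
    have "1 / real CARD('p) ^ N > 0" using padic_card_gt_1[where 'p = 'p] by simp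
    from tendstoD[OF lim this] show "\<forall>\<^sub>F i in F. padic_p ^ N dvd X i - L"
      by eventually_elim (metis padic_dist_le_iff less_imp_le)
  qed
next
  assume ev: "\<forall>N. \<forall>\<^sub>F i in F. padic_p ^ N dvd X i - L"
  show "(X \<longlongrightarrow> L) F"
  proof (rule tendstoI)
    fix e :: real assume "e > 0"
    then obtain n where n: "1 / real CARD('p) ^ n < e"
      using ex_padic_radius_less by blast
    from ev have "\<forall>\<^sub>F i in F. padic_p ^ n dvd X i - L" by blast
    then show "\<forall>\<^sub>F i in F. dist (X i) L < e"
      by eventually_elim (use n padic_dist_le_iff in \<open>meson le_less_trans\<close>)
  qed
qed

lemma continuous_on_padic_iff:
  fixes f :: "'p :: prime_card padic_int \<Rightarrow> 'p padic_int"
  shows "continuous_on UNIV f \<longleftrightarrow>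
    (\<forall>s N. \<exists>K. \<forall>t. padic_p ^ K dvd t - s \<longrightarrow> padic_p ^ N dvd f t - f s)"
proof (intro iffI allI)
  fix s N assume "continuous_on UNIV f"
  moreover have "1 / real CARD('p) ^ N > 0" using padic_card_gt_1[where 'p = 'p] by simp
  ultimately obtain d where d: "d > 0" "\<And>t. dist t s < d \<Longrightarrow> dist (f t) (f s) < 1 / real CARD('p) ^ N"
    unfolding continuous_on_iff by blast
  obtain K where "1 / real CARD('p) ^ K < d"
    using ex_padic_radius_less d(1) by blast
  then have "padic_p ^ N dvd f t - f s" if "padic_p ^ K dvd t - s" for t
    using that d(2)[of t] by (meson padic_dist_le_iff le_less_trans less_imp_le)
  then show "\<exists>K. \<forall>t. padic_p ^ K dvd t - s \<longrightarrow> padic_p ^ N dvd f t - f s" by blast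
next
  assume *: "\<forall>s N. \<exists>K. \<forall>t. padic_p ^ K dvd t - s \<longrightarrow> padic_p ^ N dvd f t - f s"
  show "continuous_on UNIV f"
    unfolding continuous_on_def tendsto_padic_iff
  proof (intro ballI allI)
    fix s N
    obtain K where K: "\<And>t. padic_p ^ K dvd t - s \<Longrightarrow> padic_p ^ N dvd f t - f s"
      using * by blast
    have "\<forall>\<^sub>F t in at s. padic_p ^ K dvd t - s"
      using tendsto_padic_iff[of "\<lambda>t. t" s "at s"] tendsto_ident_at by blast
    then show "\<forall>\<^sub>F t in at s. padic_p ^ N dvd f t - f s"
      by eventually_elim (rule K)
  qed
qed

section \<open>Separation, density of the naturals, and p-adic series\<close>

lemma padic_eq_0I:
  assumes "\<And>N. padic_p ^ N dvd (x :: 'p :: prime_card padic_int)"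
  shows "x = 0"
  by (rule padic_int_eqI) (use assms in \<open>simp add: p_power_dvd_iff zero_padic_int.rep_eq\<close>)

text \<open>The reduced residue of \<open>t\<close> at level \<open>N\<close> is such a natural
  number. This density carries statements from naturals to all p-adic integers by
  continuity.\<close>

lemma ex_nat_padic_cong: "\<exists>m. padic_p ^ N dvd of_nat m - (t :: 'p :: prime_card padic_int)"
proof -
  let ?r = "Rep_padic_int t N"
  have pos: "int CARD('p) ^ N > 0" using padic_card_gt_1[where 'p = 'p] by simp
  have r: "?r mod int CARD('p) ^ N = ?r" using Rep_padic_int_mod[of t N 0] by simp
  then have "?r \<ge> 0" using pos by (metis pos_mod_sign)
  then have "of_nat (nat ?r) = (of_int ?r :: 'p padic_int)" by (metis of_int_of_nat_eq int_nat_eq)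
  moreover have "Rep_padic_int (of_int ?r - t) N = 0"
    by (simp add: minus_padic_int.rep_eq Rep_padic_int_of_int r)
  ultimately show ?thesis by (metis p_power_dvd_iff)
qed

text \<open>By completeness and the ultrametric inequality, terms tending to 0 suffice. The sum is
  built residue by residue: level \<open>N\<close> is read off a partial sum beyond which
  \<open>p ^ N\<close> divides all terms.\<close>

lemma padic_summable:
  fixes e :: "nat \<Rightarrow> 'p :: prime_card padic_int"
  assumes "\<And>N. \<exists>M. \<forall>n\<ge>M. padic_p ^ N dvd e n"
  shows "summable e"
proof -
  let ?S = "\<lambda>M. \<Sum>n<M. e n"
  obtain M where M: "\<And>N n. n \<ge> M N \<Longrightarrow> padic_p ^ N dvd e n" using assms by metis
  have tail: "padic_p ^ N dvd ?S m - ?S (M N)" if "m \<ge> M N" for m N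
  proof -
    have "?S m - ?S (M N) = (\<Sum>n=M N..<m. e n)"
      using that by (metis sum_diff_nat_ivl lessThan_atLeast0 zero_le)
    also have "padic_p ^ N dvd \<dots>" by (intro dvd_sum) (simp add: M)
    finally show ?thesis .
  qed
  have cong: "Rep_padic_int x N = Rep_padic_int y N" if "padic_p ^ N dvd x - y"
    for x y :: "'p padic_int" and N
  proof -
    have "Rep_padic_int x N mod int CARD('p) ^ N = Rep_padic_int y N mod int CARD('p) ^ N"
      using that by (simp add: p_power_dvd_iff minus_padic_int.rep_eq mod_eq_dvd_iff dvd_eq_mod_eq_0)
    then show ?thesis using Rep_padic_int_mod[of x N 0] Rep_padic_int_mod[of y N 0] by simp
  qed
  define z where "z N = Rep_padic_int (?S (M N)) N" for N
  have "z N = z (Suc N) mod int CARD('p) ^ N" for N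
  proof -
    \<comment> \<open>\<open>M\<close> need not be monotone, so levels \<open>N\<close> and
      \<open>Suc N\<close> are compared through a partial sum late enough for both.\<close>
    let ?m = "max (M N) (M (Suc N))"
    have "z N = Rep_padic_int (?S ?m) N"
      unfolding z_def by (rule cong[symmetric]) (rule tail, simp)
    also have "\<dots> = Rep_padic_int (?S ?m) (Suc N) mod int CARD('p) ^ N"
      by (rule Rep_padic_int_step)
    also have "Rep_padic_int (?S ?m) (Suc N) = z (Suc N)"
      unfolding z_def by (rule cong) (rule tail, simp)
    finally show ?thesis .
  qed
  then have z: "Rep_padic_int (Abs_padic_int z :: 'p padic_int) = z"
    by (intro Abs_padic_int_inverse) blast
  have "padic_p ^ N dvd ?S m - Abs_padic_int z" if "m \<ge> M N" for m N
  proof -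
    have "padic_p ^ N dvd ?S (M N) - Abs_padic_int z"
      using Rep_padic_int_mod[of "?S (M N)" N 0]
      by (simp add: p_power_dvd_iff minus_padic_int.rep_eq z z_def)
    from dvd_add[OF tail[OF that] this] show ?thesis by simp
  qed
  then have "e sums Abs_padic_int z"
    unfolding sums_def tendsto_padic_iff eventually_sequentially by blast
  then show ?thesis by (rule sums_summable)
qed

lemma padic_sums_dvdD:
  fixes e :: "nat \<Rightarrow> 'p :: prime_card padic_int"
  assumes "e sums x"
  shows "\<exists>M. \<forall>m\<ge>M. padic_p ^ N dvd (\<Sum>n<m. e n) - x"
  using assms unfolding sums_def tendsto_padic_iff eventually_sequentially by blast

lemma padic_sums_dvd:
  fixes e :: "nat \<Rightarrow> 'p :: prime_card padic_int"
  assumes "e sums x" and "\<And>n. padic_p ^ N dvd e n"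
  shows "padic_p ^ N dvd x"
proof -
  obtain M where "padic_p ^ N dvd (\<Sum>n<M. e n) - x"
    using padic_sums_dvdD[OF assms(1)] by blast
  moreover have "padic_p ^ N dvd (\<Sum>n<M. e n)" by (intro dvd_sum assms(2))
  ultimately have "padic_p ^ N dvd (\<Sum>n<M. e n) - ((\<Sum>n<M. e n) - x)" by (metis dvd_diff)
  then show ?thesis by simp
qed

lemma padic_sums_diff:
  fixes a b :: "nat \<Rightarrow> 'p :: prime_card padic_int"
  assumes "a sums x" "b sums y"
  shows "(\<lambda>n. a n - b n) sums (x - y)"
  unfolding sums_def tendsto_padic_iff
proof
  fix N
  have "\<forall>\<^sub>F m in sequentially. padic_p ^ N dvd (\<Sum>n<m. a n) - x"
    and "\<forall>\<^sub>F m in sequentially. padic_p ^ N dvd (\<Sum>n<m. b n) - y"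
    using assms unfolding sums_def tendsto_padic_iff by blast+
  then show "\<forall>\<^sub>F m in sequentially. padic_p ^ N dvd (\<Sum>n<m. a n - b n) - (x - y)"
  proof eventually_elim
    case (elim m)
    then have "padic_p ^ N dvd ((\<Sum>n<m. a n) - x) - ((\<Sum>n<m. b n) - y)" by (rule dvd_diff)
    then show ?case by (simp add: sum_subtractf algebra_simps)
  qed
qed

lemma padic_sums_mult:
  fixes a :: "nat \<Rightarrow> 'p :: prime_card padic_int"
  assumes "a sums x"
  shows "(\<lambda>n. c * a n) sums (c * x)"
  unfolding sums_def tendsto_padic_iff
proof
  fix N
  have "\<forall>\<^sub>F m in sequentially. padic_p ^ N dvd (\<Sum>n<m. a n) - x"
    using assms unfolding sums_def tendsto_padic_iff by blast
  then show "\<forall>\<^sub>F m in sequentially. padic_p ^ N dvd (\<Sum>n<m. c * a n) - c * x"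
    by eventually_elim (metis dvd_mult right_diff_distrib sum_distrib_left)
qed

lemma padic_sums_Suc:
  fixes a :: "nat \<Rightarrow> 'p :: prime_card padic_int"
  assumes "(\<lambda>n. a (Suc n)) sums x"
  shows "a sums (a 0 + x)"
  unfolding sums_def tendsto_padic_iff
proof
  fix N
  have "\<forall>\<^sub>F m in sequentially. padic_p ^ N dvd (\<Sum>n<m. a (Suc n)) - x"
    using assms unfolding sums_def tendsto_padic_iff by blast
  then have "\<forall>\<^sub>F m in sequentially. padic_p ^ N dvd (\<Sum>n<Suc m. a n) - (a 0 + x)"
    by eventually_elim (simp add: sum.lessThan_Suc_shift del: sum.lessThan_Suc)
  then show "\<forall>\<^sub>F m in sequentially. padic_p ^ N dvd (\<Sum>n<m. a n) - (a 0 + x)"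
    by (rule eventually_sequentially_Suc[THEN iffD1])
qed

section \<open>Units of the p-adic integers\<close>

lemma padic_is_unit_1_minus: "is_unit (1 - padic_p * (z :: 'p :: prime_card padic_int))"
proof -
  let ?q = "padic_p * z"
  \<comment> \<open>The inverse is the geometric series in \<open>?q\<close>, whose
    \<open>n\<close>-th term is divisible by \<open>p ^ n\<close>.\<close>
  have "summable (\<lambda>n. ?q ^ n)"
  proof (rule padic_summable)
    fix N
    have "padic_p ^ N dvd ?q ^ n" if "n \<ge> N" for n
      using that by (metis dvd_mult2 le_imp_power_dvd power_mult_distrib)
    then show "\<exists>M. \<forall>n\<ge>M. padic_p ^ N dvd ?q ^ n" by blast
  qed
  then obtain w where w: "(\<lambda>n. ?q ^ n) sums w" by (auto simp: summable_def)
  have "w = 1 + ?q * w"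
    using padic_sums_Suc[of "\<lambda>n. ?q ^ n" "?q * w"] padic_sums_mult[OF w, of ?q] sums_unique2[OF w]
    by (simp only: power_Suc power_0)
  then have "1 = (1 - ?q) * w" by (simp add: algebra_simps)
  then show ?thesis by (rule dvdI)
qed

text \<open>Bezout gives an integer inverting the residue of \<open>x\<close> modulo p; its product
  with \<open>x\<close> has the form \<open>1 - padic_p * z\<close>, already known to be a
  unit.\<close>

lemma padic_is_unitI:
  assumes "\<not> padic_p dvd (x :: 'p :: prime_card padic_int)"
  shows "is_unit x"
proof -
  let ?p = "int CARD('p)" and ?r = "Rep_padic_int x 1"
  have "?r \<noteq> 0" using assms p_power_dvd_iff[of 1 x] by simp
  moreover have "?r mod ?p = ?r" using Rep_padic_int_mod[of x 1 0] by simp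
  ultimately have "\<not> ?p dvd ?r" by (simp add: dvd_eq_mod_eq_0)
  then have "coprime ?r ?p"
    using prime_imp_coprime[OF prime_card_int[where 'a = 'p]] coprime_commute by blast
  then obtain a b where ab: "a * ?r + b * ?p = 1" by (metis bezout_int coprime_imp_gcd_eq_1)
  have "padic_p ^ 1 dvd x - of_int ?r"
    using \<open>?r mod ?p = ?r\<close>
    by (subst p_power_dvd_iff) (simp add: minus_padic_int.rep_eq Rep_padic_int_of_int)
  then obtain y where "x - of_int ?r = padic_p * y" by auto
  then have x: "x = of_int ?r + padic_p * y" by (simp add: algebra_simps)
  have "of_int (a * ?r + b * ?p) = (1 :: 'p padic_int)" by (simp only: ab of_int_1)
  then have "of_int a * of_int ?r = (1 - of_int b * padic_p :: 'p padic_int)"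
    by (simp add: algebra_simps)
  moreover have "of_int a * x = of_int a * of_int ?r + of_int a * (padic_p * y)"
    by (subst x) (rule distrib_left)
  ultimately have "of_int a * x = 1 - padic_p * (of_int b - of_int a * y)"
    by (simp add: algebra_simps)
  then have "is_unit (of_int a * x)" using padic_is_unit_1_minus by metis
  then show ?thesis by (rule dvd_mult_right)
qed

lemma padic_p_not_unit: "\<not> is_unit (padic_p :: 'p :: prime_card padic_int)"
  using p_power_dvd_iff[of 1 "1 :: 'p padic_int"] padic_card_gt_1[where 'p = 'p]
  by (simp add: one_padic_int.rep_eq)

lemma padic_p_neq_0: "(padic_p :: 'p :: prime_card padic_int) \<noteq> 0"
proof
  assume "(padic_p :: 'p padic_int) = 0"
  \<comment> \<open>Level 2, because at level 1 the residue of p is 0.\<close>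
  then have "Rep_padic_int (of_int (int CARD('p)) :: 'p padic_int) 2 = 0"
    by (simp add: zero_padic_int.rep_eq)
  then have "int CARD('p) ^ 2 dvd int CARD('p)"
    by (simp only: Rep_padic_int_of_int dvd_eq_mod_eq_0)
  then show False
    using padic_card_gt_1[where 'p = 'p] by (auto dest!: zdvd_imp_le simp: power2_eq_square)
qed

lemma padic_abs_mult_unit:
  "is_unit u \<Longrightarrow> padic_abs (x * u) = padic_abs (x :: 'p :: prime_card padic_int)"
  by (auto simp: padic_abs_def dvd_mult_unit_iff)

lemma padic_is_unit_cong:
  assumes "is_unit (y :: 'p :: prime_card padic_int)" and "padic_p dvd x - y"
  shows "is_unit x"
proof (rule padic_is_unitI)
  show "\<not> padic_p dvd x"
  proof
    assume "padic_p dvd x"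
    then have "padic_p dvd x - (x - y)" using assms(2) by (rule dvd_diff)
    then show False using assms(1) padic_p_not_unit by (metis diff_diff_eq2 add_diff_cancel_left' dvd_trans)
  qed
qed

lemma padic_is_unit_of_nat:
  assumes "\<not> CARD('p) dvd m"
  shows "is_unit (of_nat m :: 'p :: prime_card padic_int)"
proof (rule padic_is_unitI)
  have "Rep_padic_int (of_int (int m) :: 'p padic_int) 1 \<noteq> 0"
    unfolding Rep_padic_int_of_int using assms by (metis dvd_eq_mod_eq_0 int_dvd_int_iff power_one_right)
  then show "\<not> padic_p dvd (of_nat m :: 'p padic_int)"
    using p_power_dvd_iff[of 1 "of_nat m :: 'p padic_int"] by simp
qed

subsection \<open>Factorials and falling factorials\<close>

text \<open>None of the factors \<open>p * q + 1\<close>, ..., \<open>p * q + r\<close> is divisible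
  by p.\<close>

lemma multiplicity_fact_add_less_prime:
  fixes p :: nat
  assumes "prime p" "r < p"
  shows "multiplicity p (fact (p * q + r) :: nat) = multiplicity p (fact (p * q) :: nat)"
  using assms(2)
proof (induction r)
  case (Suc r)
  have "\<not> p dvd Suc r" using Suc.prems by (auto dest: dvd_imp_le)
  then have "\<not> p dvd p * q + Suc r" by (simp only: dvd_add_right_iff dvd_triv_left not_False_eq_True)
  then have "\<not> p dvd Suc (p * q + r)" by simp
  then have "multiplicity p (Suc (p * q + r)) = 0" by (rule not_dvd_imp_multiplicity_0)
  moreover have "multiplicity p (Suc (p * q + r) * fact (p * q + r)) =
      multiplicity p (Suc (p * q + r)) + multiplicity p (fact (p * q + r) :: nat)"
    using assms(1) by (intro prime_elem_multiplicity_mult_distrib) auto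
  ultimately show ?case using Suc by simp
qed simp

text \<open>In each block of p new factors only the last, \<open>p * Suc q\<close>, is divisible by
  p. This is the recursion behind Legendre's formula.\<close>

lemma multiplicity_fact_prime_mult:
  fixes p :: nat
  assumes "prime p"
  shows "multiplicity p (fact (p * q) :: nat) = q + multiplicity p (fact q :: nat)"
proof (induction q)
  case (Suc q)
  have "p > 0" using assms prime_gt_0_nat by blast
  then have eq: "p * Suc q = Suc (p * q + (p - 1))" by simp
  have "multiplicity p (fact (p * Suc q) :: nat) =
      multiplicity p (p * Suc q * fact (p * q + (p - 1)))"
    by (subst (1 2) eq) (simp only: fact_Suc of_nat_id)
  also have "\<dots> = multiplicity p (p * Suc q) + multiplicity p (fact (p * q + (p - 1)) :: nat)"
    using assms \<open>p > 0\<close> by (intro prime_elem_multiplicity_mult_distrib) auto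
  also have "multiplicity p (p * Suc q) = Suc (multiplicity p (Suc q))"
    using assms \<open>p > 0\<close> by (intro multiplicity_times_same) auto
  also have "multiplicity p (fact (p * q + (p - 1)) :: nat) = q + multiplicity p (fact q :: nat)"
    using multiplicity_fact_add_less_prime[OF assms, of "p - 1" q] \<open>p > 0\<close> Suc by simp
  also have "Suc (multiplicity p (Suc q)) + (q + multiplicity p (fact q :: nat)) =
      Suc q + multiplicity p (Suc q * fact q)"
    using assms by (subst prime_elem_multiplicity_mult_distrib) auto
  finally show ?case by simp
qed simp

text \<open>With \<open>q = n div p\<close> the valuation of \<open>n!\<close> is \<open>q\<close>
  plus that of \<open>q!\<close>, and induction bounds \<open>p - 1\<close> times it by
  \<open>(p - 1) * q + q = p * q\<close>.\<close>

lemma multiplicity_fact_le: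
  fixes p :: nat
  assumes "prime p"
  shows "(p - 1) * multiplicity p (fact n :: nat) \<le> n"
proof (induction n rule: less_induct)
  case (less n)
  have p: "p > 1" using assms prime_gt_1_nat by blast
  define q where "q = n div p"
  have n: "n = p * q + n mod p" by (simp add: q_def)
  have v: "multiplicity p (fact n :: nat) = q + multiplicity p (fact q :: nat)"
    using multiplicity_fact_add_less_prime[OF assms, of "n mod p" q] p
      multiplicity_fact_prime_mult[OF assms, of q] unfolding n[symmetric] by simp
  show ?case
  proof (cases "n = 0")
    case False
    then have "q < n" using p by (simp add: q_def)
    then have "(p - 1) * (q + multiplicity p (fact q :: nat)) \<le> (p - 1) * q + q"
      using less by (simp add: distrib_left)
    also have "\<dots> = p * q" using p by (cases p) auto
    also have "\<dots> \<le> n" using n by linarith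
    finally show ?thesis by (simp add: v)
  qed simp
qed

text \<open>As 4 is not prime, p is at least 5, so the valuation of \<open>n!\<close> is at most
  \<open>n div 4\<close>; the part of \<open>n!\<close> prime to p is a unit. The power of p
  dividing \<open>D\<close> later gives both convergence and the bounds on small
  coefficients.\<close>

lemma ex_padic_p_power_over_fact:
  assumes "CARD('p :: prime_card) > 3"
  shows "\<exists>D :: 'p padic_int. of_nat (fact n) * D = padic_p ^ n \<and> padic_p ^ (n - n div 4) dvd D"
proof -
  let ?p = "CARD('p)"
  define v where "v = multiplicity ?p (fact n :: nat)"
  have pr: "prime ?p" by (rule prime_card)
  have "odd ?p" using prime_odd_nat[OF pr] assms by simp
  then have "?p \<noteq> 4" by (metis even_numeral)
  then have "4 \<le> ?p - 1" using assms by simp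
  then have "4 * v \<le> n"
    using multiplicity_fact_le[OF pr, of n] unfolding v_def by (meson le_trans mult_le_mono1)
  then have v: "v \<le> n div 4" "v \<le> n" by auto
  obtain m where m: "fact n = ?p ^ v * m" "\<not> ?p dvd m"
    unfolding v_def by (rule multiplicity_decompose'[of "fact n :: nat" ?p]) (use pr in \<open>auto simp: not_prime_unit\<close>)
  obtain i :: "'p padic_int" where i: "1 = of_nat m * i"
    using padic_is_unit_of_nat[OF m(2)] by (rule dvdE)
  define D where "D = i * padic_p ^ (n - v)"
  have "of_nat (fact n) * D = padic_p ^ v * padic_p ^ (n - v) * (of_nat m * i)"
    unfolding m(1) D_def by simp
  also have "\<dots> = padic_p ^ n" using v by (simp flip: i power_add)
  finally have "of_nat (fact n) * D = padic_p ^ n" .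
  moreover have "padic_p ^ (n - n div 4) dvd D"
    unfolding D_def using v by (intro dvd_mult le_imp_power_dvd) simp
  ultimately show ?thesis by blast
qed

text \<open>Replaces the Mahler function \<open>t choose n\<close>, keeping the factor
  \<open>n!\<close> so that nothing has to be divided; the denominators go into the coefficients
  \<open>p ^ n / n!\<close>.\<close>

definition falling :: "nat \<Rightarrow> 'a :: comm_ring_1 \<Rightarrow> 'a" where
  "falling n t = (\<Prod>i<n. t - of_nat i)"

lemma falling_0 [simp]: "falling 0 t = 1"
  by (simp add: falling_def)

lemma falling_Suc: "falling (Suc n) t = falling n t * (t - of_nat n)"
  by (simp add: falling_def)

text \<open>Used to split the factor \<open>t\<close> off a series vanishing at 0, leaving a series
  in \<open>t - 1\<close>.\<close>

lemma falling_Suc_left: "falling (Suc n) t = t * falling n (t - 1)"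
  by (simp add: falling_def prod.lessThan_Suc_shift algebra_simps del: prod.lessThan_Suc)

lemma falling_of_nat: "falling n (of_nat m) = of_nat (fact n * (m choose n))"
proof (induction n)
  case (Suc n)
  show ?case
  proof (cases "n \<le> m")
    case True
    have "fact (Suc n) * (m choose Suc n) = fact n * (Suc n * (m choose Suc n))"
      by (simp only: fact_Suc of_nat_id mult_ac)
    also have "Suc n * (m choose Suc n) = (m - n) * (m choose n)"
      by (metis binomial_absorb_comp binomial_absorption mult.commute)
    finally have "fact (Suc n) * (m choose Suc n) = fact n * (m choose n) * (m - n)"
      by simp
    then show ?thesis using True Suc by (simp add: falling_Suc of_nat_diff del: fact_Suc)
  qed (simp add: falling_Suc Suc binomial_eq_0)
qed simp

lemma falling_cong: "d dvd t - s \<Longrightarrow> d dvd falling n t - falling n s"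
proof (induction n)
  case (Suc n)
  have "falling (Suc n) t - falling (Suc n) s =
      (falling n t - falling n s) * (t - of_nat n) + falling n s * (t - s)"
    by (simp add: falling_Suc algebra_simps)
  then show ?case using Suc by simp
qed simp

text \<open>The divided difference of \<open>falling n\<close> between \<open>t\<close> and
  \<open>s\<close>, given by recursion so that it is also defined at \<open>t = s\<close>.\<close>

primrec falling_quot :: "nat \<Rightarrow> 'a :: comm_ring_1 \<Rightarrow> 'a \<Rightarrow> 'a" where
  "falling_quot 0 t s = 0"
| "falling_quot (Suc n) t s = falling_quot n t s * (t - of_nat n) + falling n s"

lemma falling_diff: "falling n t - falling n s = (t - s) * falling_quot n t s"
proof (induction n)
  case (Suc n)
  have "falling (Suc n) t - falling (Suc n) s =
      (falling n t - falling n s) * (t - of_nat n) + falling n s * (t - s)"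
    by (simp add: falling_Suc algebra_simps)
  then show ?case by (simp add: Suc algebra_simps)
qed simp

lemma falling_quot_cong: "d dvd t - t' \<Longrightarrow> d dvd falling_quot n t s - falling_quot n t' s"
proof (induction n)
  case (Suc n)
  have "falling_quot (Suc n) t s - falling_quot (Suc n) t' s =
      (falling_quot n t s - falling_quot n t' s) * (t - of_nat n) + falling_quot n t' s * (t - t')"
    by (simp add: algebra_simps)
  then show ?case using Suc by simp
qed simp

subsection \<open>Series of falling factorials\<close>

text \<open>Modulo p the series is \<open>d 0 + d 1 * t\<close> with unit slope, so its divided
  differences are congruent to \<open>d 1\<close> and Newton iteration finds a zero. The cofactor
  \<open>u\<close> is the divided difference at that zero.\<close>

lemma padic_falling_series_zero:
  fixes d :: "nat \<Rightarrow> 'p :: prime_card padic_int"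
  assumes lim: "\<And>N. \<exists>M. \<forall>n\<ge>M. padic_p ^ N dvd d n"
    and unit: "is_unit (d 1)"
    and small: "\<And>n. n \<ge> 2 \<Longrightarrow> padic_p dvd d n"
  shows "\<exists>\<tau> u. continuous_on UNIV u \<and>
           (\<forall>t. (\<lambda>n. d n * falling n t) sums ((t - \<tau>) * u t)) \<and> (\<forall>t. padic_p dvd u t - d 1)"
proof -
  define H where "H t = (\<Sum>n. d n * falling n t)" for t
  define U where "U t s = (\<Sum>n. d n * falling_quot n t s)" for t s
  have summ: "summable (\<lambda>n. d n * w n)" for w
  proof (rule padic_summable)
    show "\<exists>M. \<forall>n\<ge>M. padic_p ^ N dvd d n * w n" for N using lim[of N] dvd_mult2 by blast
  qed
  have H: "(\<lambda>n. d n * falling n t) sums H t" for t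
    unfolding H_def using summ by (rule summable_sums)
  have U: "(\<lambda>n. d n * falling_quot n t s) sums U t s" for t s
    unfolding U_def using summ by (rule summable_sums)
  have HU: "H t - H s = (t - s) * U t s" for t s
  proof (rule sums_unique2)
    show "(\<lambda>n. d n * falling n t - d n * falling n s) sums (H t - H s)"
      by (rule padic_sums_diff[OF H H])
    have "(\<lambda>n. d n * falling n t - d n * falling n s) = (\<lambda>n. (t - s) * (d n * falling_quot n t s))"
      by (simp add: mult.left_commute flip: right_diff_distrib falling_diff)
    then show "(\<lambda>n. d n * falling n t - d n * falling n s) sums ((t - s) * U t s)"
      using padic_sums_mult[OF U] by simp
  qed
  \<comment> \<open>\<open>falling_quot\<close> is 0 for \<open>n = 0\<close> and 1 for
    \<open>n = 1\<close>; all later coefficients are multiples of p.\<close>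
  have U1: "padic_p dvd U t s - d 1" for t s
  proof -
    have *: "(\<lambda>n. if n = 1 then d 1 else 0) sums d 1" using sums_single[of 1 "\<lambda>_. d 1"] by simp
    have "padic_p ^ 1 dvd U t s - d 1"
    proof (rule padic_sums_dvd[OF padic_sums_diff[OF U *]])
      fix n :: nat
      consider "n = 0" | "n = 1" | "n \<ge> 2" by linarith
      then show "padic_p ^ 1 dvd d n * falling_quot n t s - (if n = 1 then d 1 else 0)"
        by cases (simp_all add: small)
    qed
    then show ?thesis by simp
  qed
  obtain e where e: "1 = d 1 * e" using unit by (rule dvdE)
  \<comment> \<open>Newton iteration with the constant slope \<open>d 1\<close>, whose inverse is \<open>e\<close>\<close>
  define x where "x = rec_nat 0 (\<lambda>_ y. y - H y * e)"
  have x_Suc: "x (Suc k) = x k - H (x k) * e" for k by (simp add: x_def)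
  \<comment> \<open>Since \<open>d 1 * e = 1\<close>, the linear part cancels and the new value is
    the old one times \<open>- (U - d 1) * e\<close>, which gains a factor p.\<close>
  have Hx: "padic_p ^ k dvd H (x k)" for k
  proof (induction k)
    case (Suc k)
    have "H (x (Suc k)) = H (x k) + (x (Suc k) - x k) * U (x (Suc k)) (x k)"
      by (simp flip: HU)
    also have "\<dots> = H (x k) * (d 1 * e) - H (x k) * e * U (x (Suc k)) (x k)"
      using arg_cong[OF e, of "\<lambda>y. H (x k) * y"] by (simp add: x_Suc)
    also have "\<dots> = - (H (x k) * (U (x (Suc k)) (x k) - d 1) * e)"
      by (simp add: algebra_simps)
    finally show ?case
      using mult_dvd_mono[OF Suc U1] by (simp add: mult.commute)
  qed simp
  have "\<exists>\<tau>. \<forall>N. \<exists>k\<ge>N. padic_p ^ N dvd x k - \<tau>"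
  proof -
    have "summable (\<lambda>k. - (H (x k) * e))"
    proof (rule padic_summable)
      fix N
      have "padic_p ^ N dvd - (H (x k) * e)" if "k \<ge> N" for k
        using that Hx[of k] by (meson dvd_minus_iff dvd_mult2 dvd_trans le_imp_power_dvd)
      then show "\<exists>M. \<forall>n\<ge>M. padic_p ^ N dvd - (H (x n) * e)" by blast
    qed
    then obtain \<tau> where \<tau>: "(\<lambda>k. - (H (x k) * e)) sums \<tau>" by (auto simp: summable_def)
    \<comment> \<open>The iteration starts at 0, so its iterates are exactly the partial sums of the
      corrections.\<close>
    have "(\<Sum>k<n. - (H (x k) * e)) = x n" for n
    proof (induction n)
      case (Suc n)
      then show ?case by (simp add: x_Suc)
    qed (simp add: x_def)
    then show ?thesis using padic_sums_dvdD[OF \<tau>] by (metis nle_le)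
  qed
  then obtain \<tau> where \<tau>: "\<And>N. \<exists>k\<ge>N. padic_p ^ N dvd x k - \<tau>" by blast
  have "H \<tau> = 0"
  proof (rule padic_eq_0I)
    fix N
    obtain k where k: "k \<ge> N" "padic_p ^ N dvd x k - \<tau>" using \<tau> by blast
    have "padic_p ^ N dvd H (x k)" using k(1) Hx by (meson dvd_trans le_imp_power_dvd)
    moreover have "padic_p ^ N dvd H (x k) - H \<tau>" unfolding HU using k(2) by (rule dvd_mult2)
    ultimately have "padic_p ^ N dvd H (x k) - (H (x k) - H \<tau>)" by (rule dvd_diff)
    then show "padic_p ^ N dvd H \<tau>" by simp
  qed
  then have "(\<lambda>n. d n * falling n t) sums ((t - \<tau>) * U t \<tau>)" for t
    using H[of t] HU[of t \<tau>] by simp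
  moreover have "continuous_on UNIV (\<lambda>t. U t \<tau>)"
    unfolding continuous_on_padic_iff
  proof (intro allI exI impI)
    \<comment> \<open>The modulus of continuity is \<open>N\<close> itself, since
      \<open>falling_quot\<close> preserves congruences in its first argument for every
      \<open>n\<close>.\<close>
    fix s N t assume "padic_p ^ N dvd t - (s :: 'p padic_int)"
    then have "padic_p ^ N dvd d n * falling_quot n t \<tau> - d n * falling_quot n s \<tau>" for n
      by (metis dvd_mult falling_quot_cong right_diff_distrib)
    then show "padic_p ^ N dvd U t \<tau> - U s \<tau>"
      by (rule padic_sums_dvd[OF padic_sums_diff[OF U U]])
  qed
  ultimately show ?thesis using U1 by blast
qed

subsection \<open>Newton series\<close>

lemma fdiff_0 [simp]: "fdiff 0 f s = f s"
  by (simp add: fdiff_def)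

text \<open>Pascal's rule splits the sum: one half is the difference at \<open>s + 1\<close>, the
  other, completed by the term of index 0, is minus the difference at \<open>s\<close>.\<close>

lemma fdiff_Suc: "fdiff (Suc n) f s = fdiff n f (s + 1) - fdiff n f s"
proof -
  let ?a = "\<lambda>\<nu>. (- 1) ^ (n - \<nu>) * f (s + 1 + of_nat \<nu>)"
  let ?b = "\<lambda>\<nu>. of_nat (n choose \<nu>) * (- 1) ^ (Suc n - \<nu>) * f (s + of_nat \<nu>)"
  have "fdiff (Suc n) f s = (- 1) ^ Suc n * f s + (\<Sum>\<nu>\<le>n. of_nat (Suc n choose Suc \<nu>) * ?a \<nu>)"
    unfolding fdiff_def atLeast0AtMost
    by (subst sum.atMost_Suc_shift) (simp add: algebra_simps)
  also have "(\<Sum>\<nu>\<le>n. of_nat (Suc n choose Suc \<nu>) * ?a \<nu>) =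
      (\<Sum>\<nu>\<le>n. of_nat (n choose \<nu>) * ?a \<nu>) + (\<Sum>\<nu>\<le>n. of_nat (n choose Suc \<nu>) * ?a \<nu>)"
    by (simp add: distrib_right sum.distrib)
  also have "(\<Sum>\<nu>\<le>n. of_nat (n choose \<nu>) * ?a \<nu>) = fdiff n f (s + 1)"
    by (simp add: fdiff_def atLeast0AtMost mult.assoc)
  also have "(- 1) ^ Suc n * f s + (fdiff n f (s + 1) + (\<Sum>\<nu>\<le>n. of_nat (n choose Suc \<nu>) * ?a \<nu>)) =
      fdiff n f (s + 1) + (\<Sum>\<nu>\<le>Suc n. ?b \<nu>)"
    by (subst sum.atMost_Suc_shift) (simp add: algebra_simps)
  also have "(\<Sum>\<nu>\<le>Suc n. ?b \<nu>) = (\<Sum>\<nu>\<le>n. ?b \<nu>)" by (simp add: binomial_eq_0)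
  also have "\<dots> = - fdiff n f s"
    unfolding fdiff_def atLeast0AtMost sum_negf[symmetric]
    by (rule sum.cong) (simp_all add: Suc_diff_le)
  finally show ?thesis by simp
qed

text \<open>Induction with the base point moved to \<open>s + 1\<close>; \<open>fdiff_Suc\<close>
  brings it back to \<open>s\<close> and Pascal's rule recombines the coefficients.\<close>

lemma newton_forward: "f (s + of_nat m) = (\<Sum>n\<le>m. of_nat (m choose n) * fdiff n f s)"
proof (induction m arbitrary: s)
  case (Suc m)
  have "f (s + of_nat (Suc m)) = f (s + 1 + of_nat m)" by (simp add: algebra_simps)
  also have "\<dots> = (\<Sum>n\<le>m. of_nat (m choose n) * fdiff n f (s + 1))" by (rule Suc)
  also have "\<dots> = (\<Sum>n\<le>m. of_nat (m choose n) * fdiff n f s) +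
      (\<Sum>n\<le>m. of_nat (m choose n) * fdiff (Suc n) f s)"
    by (simp add: fdiff_Suc algebra_simps flip: sum.distrib)
  also have "(\<Sum>n\<le>m. of_nat (m choose n) * fdiff n f s) =
      (\<Sum>n\<le>Suc m. of_nat (m choose n) * fdiff n f s)"
    by (simp add: binomial_eq_0)
  also have "\<dots> = f s + (\<Sum>n\<le>m. of_nat (m choose Suc n) * fdiff (Suc n) f s)"
    by (subst sum.atMost_Suc_shift) simp
  also have "\<dots> + (\<Sum>n\<le>m. of_nat (m choose n) * fdiff (Suc n) f s) =
      f s + (\<Sum>n\<le>m. of_nat (Suc m choose Suc n) * fdiff (Suc n) f s)"
    by (simp add: algebra_simps flip: sum.distrib)
  also have "\<dots> = (\<Sum>n\<le>Suc m. of_nat (Suc m choose n) * fdiff n f s)"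
    by (subst sum.atMost_Suc_shift) simp
  finally show ?case .
qed simp

lemma kummer2_fdiff_div:
  assumes "f \<in> kummer2"
  shows "padic_p ^ n * (fdiff n f s div padic_p ^ n) = fdiff n (f :: 'p :: prime_card padic_int \<Rightarrow> _) s"
  using assms by (intro dvd_mult_div_cancel) (auto simp: kummer2_def)

text \<open>At natural \<open>t\<close> this is the finite Newton formula with \<open>1 / n!\<close>
  absorbed into \<open>D\<close>. A partial sum past which \<open>p ^ N\<close> divides
  \<open>D\<close> agrees with \<open>f\<close> modulo \<open>p ^ N\<close> at all naturals at once;
  density and continuity extend this to every \<open>t\<close>.\<close>

lemma kummer2_newton_series:
  fixes f :: "'p :: prime_card padic_int \<Rightarrow> 'p padic_int"
  assumes f: "f \<in> kummer2" "continuous_on UNIV f"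
    and D: "\<And>n. of_nat (fact n) * D n = padic_p ^ n"
      "\<And>N. \<exists>M. \<forall>n\<ge>M. padic_p ^ N dvd D n"
  shows "(\<lambda>n. fdiff n f s div padic_p ^ n * D n * falling n t) sums f (s + t)"
proof -
  define c where "c n = fdiff n f s div padic_p ^ n * D n" for n
  have c: "c n * of_nat (fact n) = fdiff n f s" for n
    using kummer2_fdiff_div[OF f(1), of n s] D(1)[of n]
    by (simp add: c_def mult.assoc) (simp add: mult.commute)
  have nat: "padic_p ^ N dvd (\<Sum>n<M. c n * falling n (of_nat m)) - f (s + of_nat m)"
    if M: "\<forall>n\<ge>M. padic_p ^ N dvd D n" for M N m
  proof -
    \<comment> \<open>Long enough to contain both the first \<open>M\<close> terms and all nonzero
      terms, which have \<open>n \<le> m\<close>.\<close>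
    let ?K = "max M (Suc m)" and ?g = "\<lambda>n. c n * falling n (of_nat m)"
    have "f (s + of_nat m) = (\<Sum>n\<le>m. ?g n)"
      unfolding newton_forward falling_of_nat by (simp flip: c add: algebra_simps)
    also have "\<dots> = (\<Sum>n<?K. ?g n)"
      by (rule sum.mono_neutral_left) (auto simp: falling_of_nat binomial_eq_0)
    also have "(\<Sum>n<?K. ?g n) = (\<Sum>n<M. ?g n) + (\<Sum>n=M..<?K. ?g n)"
      unfolding lessThan_atLeast0 by (rule sum.atLeastLessThan_concat[symmetric]) auto
    finally have "(\<Sum>n<M. ?g n) - f (s + of_nat m) = - (\<Sum>n=M..<?K. ?g n)" by simp
    moreover have "padic_p ^ N dvd (\<Sum>n=M..<?K. ?g n)"
      using M by (intro dvd_sum) (simp add: c_def)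
    ultimately show ?thesis by simp
  qed
  have "padic_p ^ N dvd (\<Sum>n<M. c n * falling n t) - f (s + t)"
    if M: "\<forall>n\<ge>M. padic_p ^ N dvd D n" for M N
  proof -
    let ?P = "\<lambda>t. \<Sum>n<M. c n * falling n t"
    obtain K where K: "\<And>r. padic_p ^ K dvd r - (s + t) \<Longrightarrow> padic_p ^ N dvd f r - f (s + t)"
      using f(2) unfolding continuous_on_padic_iff by metis
    \<comment> \<open>\<open>N\<close> controls the polynomial partial sum, \<open>K\<close> the
      value of \<open>f\<close>.\<close>
    obtain m where m: "padic_p ^ (N + K) dvd of_nat m - t" using ex_nat_padic_cong by blast
    then have mN: "padic_p ^ N dvd of_nat m - t" and mK: "padic_p ^ K dvd of_nat m - t"
      by (metis power_add dvd_mult_left dvd_mult_right)+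
    have "padic_p ^ N dvd ?P (of_nat m) - ?P t"
      unfolding sum_subtractf[symmetric] right_diff_distrib[symmetric]
      by (intro dvd_sum dvd_mult falling_cong mN)
    moreover have "padic_p ^ N dvd f (s + of_nat m) - f (s + t)"
      by (rule K) (simp add: mK)
    ultimately have "padic_p ^ N dvd (?P (of_nat m) - f (s + of_nat m)) +
        (f (s + of_nat m) - f (s + t)) - (?P (of_nat m) - ?P t)"
      using dvd_diff[OF dvd_add[OF nat[OF M]]] by blast
    then show ?thesis by simp
  qed
  with D(2) have "(\<lambda>n. c n * falling n t) sums f (s + t)"
    unfolding sums_def tendsto_padic_iff eventually_sequentially by (metis (no_types, lifting) le_trans)
  then show ?thesis by (simp add: c_def)
qed

section \<open>Dependence of the differences on the base point\<close>

lemma continuous_on_fdiff: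
  fixes f :: "'p :: prime_card padic_int \<Rightarrow> 'p padic_int"
  assumes f: "continuous_on UNIV f"
  shows "continuous_on UNIV (fdiff n f)"
proof (induction n)
  case 0
  then show ?case using f by simp
next
  case (Suc n)
  show ?case
    unfolding continuous_on_padic_iff
  proof (intro allI)
    fix s :: "'p padic_int" and N
    obtain K1 K2
      where K1: "\<And>t. padic_p ^ K1 dvd t - (s + 1) \<Longrightarrow> padic_p ^ N dvd fdiff n f t - fdiff n f (s + 1)"
        and K2: "\<And>t. padic_p ^ K2 dvd t - s \<Longrightarrow> padic_p ^ N dvd fdiff n f t - fdiff n f s"
      using Suc unfolding continuous_on_padic_iff by metis
    have "padic_p ^ N dvd fdiff (Suc n) f t - fdiff (Suc n) f s"
      if "padic_p ^ (K1 + K2) dvd t - s" for t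
    proof -
      from that have "padic_p ^ K1 dvd t - s" "padic_p ^ K2 dvd t - s"
        by (metis power_add dvd_mult_left dvd_mult_right)+
      from dvd_diff[OF K1[of "t + 1"] K2[OF this(2)]] this(1)
      have "padic_p ^ N dvd (fdiff n f (t + 1) - fdiff n f (s + 1)) - (fdiff n f t - fdiff n f s)"
        by simp
      then show ?thesis by (simp add: fdiff_Suc algebra_simps)
    qed
    then show "\<exists>K. \<forall>t. padic_p ^ K dvd t - s \<longrightarrow> padic_p ^ N dvd fdiff (Suc n) f t - fdiff (Suc n) f s"
      by blast
  qed
qed

text \<open>A unit step of the base point changes the \<open>n\<close>-th difference by the next
  one, a multiple of \<open>p ^ Suc n\<close>. Density and continuity reach every \<open>s\<close>,
  so hypotheses at 0 can be used at a zero of \<open>f\<close>.\<close>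

lemma kummer2_fdiff_cong:
  fixes f :: "'p :: prime_card padic_int \<Rightarrow> 'p padic_int"
  assumes f: "f \<in> kummer2" "continuous_on UNIV f"
  shows "padic_p dvd fdiff n f s div padic_p ^ n - Delta_coeff f n"
proof -
  have nat: "padic_p ^ Suc n dvd fdiff n f (of_nat m) - fdiff n f 0" for m
  proof (induction m)
    case (Suc m)
    have "padic_p ^ Suc n dvd fdiff n f (of_nat m + 1) - fdiff n f (of_nat m)"
      using f(1) unfolding fdiff_Suc[symmetric] kummer2_def by blast
    from dvd_add[OF this Suc] show ?case by (simp add: add.commute)
  qed simp
  obtain K where K: "\<And>t. padic_p ^ K dvd t - s \<Longrightarrow> padic_p ^ Suc n dvd fdiff n f t - fdiff n f s"
    using continuous_on_fdiff[OF f(2)] unfolding continuous_on_padic_iff by metis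
  obtain m where "padic_p ^ K dvd of_nat m - s" using ex_nat_padic_cong by blast
  then have "padic_p ^ Suc n dvd fdiff n f (of_nat m) - fdiff n f s"
    by (rule K)
  from dvd_diff[OF nat[of m] this] have "padic_p ^ Suc n dvd fdiff n f s - fdiff n f 0" by simp
  also have "fdiff n f s - fdiff n f 0 =
      padic_p ^ n * (fdiff n f s div padic_p ^ n - Delta_coeff f n)"
    by (simp add: Delta_coeff_def kummer2_fdiff_div[OF f(1)] right_diff_distrib)
  finally show ?thesis by (simp only: power_Suc2) (simp add: padic_p_neq_0)
qed

lemma Delta_res_cong:
  fixes f :: "'p :: prime_card padic_int \<Rightarrow> 'p padic_int"
  shows "padic_p dvd Delta_coeff f 1 - of_int (Delta_res f)"
  using theI'[OF ex1_residue[of "Delta_coeff f 1"]] by (simp add: Delta_res_def)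

section \<open>Factorization of \<open>f\<close> around a given zero\<close>

theorem theorem5p15:
  fixes f :: "'p :: prime_card padic_int \<Rightarrow> 'p padic_int"
  assumes "CARD('p) > 3"
    and "f \<in> kummer2"
    and "continuous_on UNIV f"
    and "Delta_res f = 0"
    and "is_unit (Delta_coeff f 2)"
    and "\<exists>\<xi>. f \<xi> = 0"
  shows "\<exists>\<xi>\<^sub>1 \<xi>\<^sub>2 fstar.
           f \<xi>\<^sub>1 = 0 \<and> f \<xi>\<^sub>2 = 0 \<and>
           continuous_on UNIV fstar \<and>
           (\<forall>s. is_unit (fstar s)) \<and>
           (\<forall>s. f s = of_nat CARD('p) ^ 2 * (s - \<xi>\<^sub>1) * (s - \<xi>\<^sub>2) * fstar s) \<and>
           (\<forall>s. padic_abs (f s) = padic_abs (of_nat CARD('p) ^ 2 * (s - \<xi>\<^sub>1) * (s - \<xi>\<^sub>2))) \<and>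
           (\<forall>s. of_nat CARD('p) dvd fstar s - Delta_coeff f 2 div 2)"
proof -
  note f = assms(2,3)
  note p0 = padic_p_neq_0[where 'p = 'p]
  obtain \<xi> where \<xi>: "f \<xi> = 0" using assms(6) by blast
  obtain D :: "nat \<Rightarrow> 'p padic_int" where D: "\<And>n. of_nat (fact n) * D n = padic_p ^ n"
    and D_dvd: "\<And>n. padic_p ^ (n - n div 4) dvd D n"
    using ex_padic_p_power_over_fact[OF assms(1)] by metis
  have D_dvd': "padic_p ^ N dvd D n" if "N \<le> n - n div 4" for N n
    using that D_dvd[of n] by (meson dvd_trans le_imp_power_dvd)
  define b where "b n = fdiff n f \<xi> div padic_p ^ n" for n
  define c where "c n = b n * D n" for n
  have c_sums: "(\<lambda>n. c n * falling n t) sums f (\<xi> + t)" for t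
    unfolding c_def b_def
  proof (rule kummer2_newton_series[OF f D])
    fix N
    have "\<forall>n\<ge>2 * N. padic_p ^ N dvd D n" by (intro allI impI D_dvd') linarith
    then show "\<exists>M. \<forall>n\<ge>M. padic_p ^ N dvd D n" by blast
  qed
  have b_cong: "padic_p dvd b n - Delta_coeff f n" for n
    unfolding b_def by (rule kummer2_fdiff_cong[OF f])
  have c_dvd: "padic_p ^ N dvd c n" if "N \<le> n - n div 4" for N n
    unfolding c_def using D_dvd'[OF that] by (rule dvd_mult)
  have c0: "c 0 = 0" by (simp add: c_def b_def \<xi>)
  \<comment> \<open>The first coefficient gets one p from \<open>b 1\<close>, because
    \<open>Delta_res f = 0\<close>, and one from \<open>D 1\<close>. From index 2 on,
    \<open>D\<close> alone supplies \<open>p ^ 2\<close>.\<close>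
  have c2: "padic_p ^ 2 dvd c (Suc n)" for n
  proof (cases "n = 0")
    case True
    have "padic_p dvd Delta_coeff f 1" using Delta_res_cong[of f] assms(4) by simp
    then have "padic_p dvd (b 1 - Delta_coeff f 1) + Delta_coeff f 1"
      using b_cong by (rule dvd_add[rotated])
    then have "padic_p dvd b 1" by simp
    moreover have "padic_p dvd D 1" using D_dvd'[of 1 1] by simp
    ultimately show ?thesis using True by (simp add: c_def power2_eq_square mult_dvd_mono)
  qed (rule c_dvd, linarith)
  \<comment> \<open>The index drops by one because the factor \<open>t\<close> is split off;
    \<open>d n\<close> will multiply \<open>falling n (t - 1)\<close>.\<close>
  define d where "d n = c (Suc n) div padic_p ^ 2" for n
  have d: "padic_p ^ 2 * d n = c (Suc n)" for n
    unfolding d_def using c2 by (rule dvd_mult_div_cancel)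
  have d_dvd: "padic_p ^ N dvd d n" if "N + 2 \<le> Suc n - Suc n div 4" for N n
  proof -
    have "padic_p ^ 2 * padic_p ^ N dvd padic_p ^ 2 * d n"
      using c_dvd[OF that] by (simp add: d add.commute flip: power_add)
    then show ?thesis using p0 by simp
  qed
  have "padic_p ^ 2 * (2 * d 1) = b 2 * (of_nat (fact 2) * D 2)"
    using d[of 1] by (simp add: c_def numeral_2_eq_2 algebra_simps)
  also have "\<dots> = padic_p ^ 2 * b 2" unfolding D by (rule mult.commute)
  finally have d1: "2 * d 1 = b 2" using p0 by simp
  \<comment> \<open>\<open>b 2\<close> is congruent to the unit \<open>Delta_coeff f 2\<close>; a
    unit product makes both factors units, including 2.\<close>
  have "is_unit (2 * d 1)" unfolding d1 using assms(5) b_cong by (rule padic_is_unit_cong)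
  then have d1_unit: "is_unit (d 1)" and two: "is_unit (2 :: 'p padic_int)"
    by (simp_all only: is_unit_mult_iff)
  obtain \<tau> u where u: "continuous_on UNIV u" "\<And>t. padic_p dvd u t - d 1"
    and d_sums: "\<And>t. (\<lambda>n. d n * falling n t) sums ((t - \<tau>) * u t)"
  proof -
    have lim: "\<exists>M. \<forall>n\<ge>M. padic_p ^ N dvd d n" for N
    proof -
      have "\<forall>n\<ge>2 * N + 4. padic_p ^ N dvd d n" by (intro allI impI d_dvd) linarith
      then show ?thesis by blast
    qed
    have small: "padic_p dvd d n" if "n \<ge> 2" for n
    proof -
      \<comment> \<open>Here \<open>c (Suc n)\<close> has index at least 3, hence is divisible by
        \<open>p ^ 3\<close>; one p survives the division by \<open>p ^ 2\<close>.\<close>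
      have "1 + 2 \<le> Suc n - Suc n div 4" using that by linarith
      from d_dvd[OF this] show ?thesis by simp
    qed
    show thesis
      using padic_falling_series_zero[of d, OF lim d1_unit small] that by blast
  qed
  \<comment> \<open>The reduced series has argument \<open>t - 1\<close> with
    \<open>t = s - \<xi>\<close>, so its zero \<open>\<tau>\<close> corresponds to
    \<open>s = \<xi> + 1 + \<tau>\<close>.\<close>
  define fstar where "fstar s = u (s - \<xi> - 1)" for s
  define \<xi>' where "\<xi>' = \<xi> + 1 + \<tau>"
  have factor: "f s = padic_p ^ 2 * (s - \<xi>) * (s - \<xi>') * fstar s" for s
  proof -
    define t where "t = s - \<xi>"
    have "(\<lambda>n. padic_p ^ 2 * t * (d n * falling n (t - 1))) sums
        (padic_p ^ 2 * t * ((t - 1 - \<tau>) * u (t - 1)))"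
      by (rule padic_sums_mult[OF d_sums])
    \<comment> \<open>This is the Newton series of \<open>f\<close> without its constant term, which
      is zero by \<open>c0\<close>.\<close>
    also have "(\<lambda>n. padic_p ^ 2 * t * (d n * falling n (t - 1))) =
        (\<lambda>n. c (Suc n) * falling (Suc n) t)"
      by (simp add: falling_Suc_left algebra_simps flip: d)
    finally have "(\<lambda>n. c n * falling n t) sums
        (c 0 * falling 0 t + padic_p ^ 2 * t * ((t - 1 - \<tau>) * u (t - 1)))"
      by (rule padic_sums_Suc)
    then have "f (\<xi> + t) = padic_p ^ 2 * t * ((t - 1 - \<tau>) * u (t - 1))"
      using sums_unique2[OF c_sums] by (simp add: c0)
    then show ?thesis by (simp add: t_def fstar_def \<xi>'_def algebra_simps)
  qed
  have fstar_cong: "padic_p dvd fstar s - d 1" for s unfolding fstar_def by (rule u(2))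
  have fstar_unit: "is_unit (fstar s)" for s
    using d1_unit fstar_cong by (rule padic_is_unit_cong)
  have "f \<xi>' = 0" by (simp add: factor)
  moreover have "continuous_on UNIV fstar"
    unfolding continuous_on_padic_iff
  proof (intro allI)
    fix s N
    obtain K where K: "\<And>t. padic_p ^ K dvd t - (s - \<xi> - 1) \<Longrightarrow> padic_p ^ N dvd u t - u (s - \<xi> - 1)"
      using u(1) unfolding continuous_on_padic_iff by metis
    have "padic_p ^ N dvd fstar t - fstar s" if "padic_p ^ K dvd t - s" for t
      unfolding fstar_def by (rule K) (simp add: that)
    then show "\<exists>K. \<forall>t. padic_p ^ K dvd t - s \<longrightarrow> padic_p ^ N dvd fstar t - fstar s" by blast
  qed
  moreover have "padic_abs (f s) = padic_abs (padic_p ^ 2 * (s - \<xi>) * (s - \<xi>'))" for s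
    unfolding factor[of s] using fstar_unit[of s] by (rule padic_abs_mult_unit)
  moreover have "padic_p dvd fstar s - Delta_coeff f 2 div 2" for s
  proof -
    \<comment> \<open>As 2 is a unit, \<open>div\<close> gives the true half and not the default 0;
      the unit 2 is then cancelled from the congruence for \<open>b 2\<close>.\<close>
    have "2 * (Delta_coeff f 2 div 2) = Delta_coeff f 2"
      using two by (intro dvd_mult_div_cancel) (rule unit_imp_dvd)
    then have "2 * (d 1 - Delta_coeff f 2 div 2) = b 2 - Delta_coeff f 2"
      by (simp only: right_diff_distrib d1)
    then have "padic_p dvd d 1 - Delta_coeff f 2 div 2"
      using b_cong[of 2] two by (metis dvd_mult_unit_iff')
    from dvd_add[OF fstar_cong[of s] this] show ?thesis by simp
  qed
  ultimately show ?thesis using \<xi> factor fstar_unit by blast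
qed

end
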